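(* There is a bijection $\Phi$ from the set of P-positions of three-pile Nim to the set of cells of the three-branch Ulam–Warburton automaton such that for every P-position $P=(p_1,p_2,p_3)$ with $p_1+p_2+p_3=2n$, the cell $\Phi(P)$ is born in generation $n$, and such that $P_1$ is a parent of $P_2$ (in the Nim sense) if and only if $\Phi(P_1)$ is the parent of $\Phi(P_2)$ (in the automaton sense). In other words, the evolution graph of three-pile Nim is isomorphic, as a rooted tree graded by generation, to the evolution graph of the three-branch Ulam–Warburton automaton.
   Context: A P-position of three-pile Nim is a triple $(p_1,p_2,p_3)$ of non-negative integers with $p_1\oplus p_2\oplus p_3=0$, where $\oplus$ is bitwise XOR. For a position $P$, $\#(P)$ is its total number of counters. A P-position $P_1$ is a parent of a P-position $P_2$ (and $P_2$ a child of $P_1$) if $\#(P_1)+2=\#(P_2)$ and $P_1$ is obtained from $P_2$ by subtracting one counter from each of two distinct piles. The evolution graph of Nim has the P-positions as vertices and parent–child pairs as edges; the P-position $P$ has generation $\#(P)/2$ (the zero position $(0,0,0)$ being generation $0$). The three-branch Ulam–Warburton automaton lives on the integer grid $\mathbb{Z}^2$, with cells in the forbidden region $\{(x,y): y<0,\ y\le -|x|\}$ never allowed to be born. In generation $0$ only the cell $(0,0)$ is alive. In generation $n+1$, every grid point that is not yet alive, not in the forbidden region, and has exactly one alive neighbor among its four horizontal/vertical neighbors is born; that unique alive neighbor is its parent. The evolution graph of the automaton has the alive cells as vertices and parent–child pairs as edges. *)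

theory Defs
  imports Main
begin

unbundle bit_operations_syntax

type_synonym position = "nat \<times> nat \<times> nat"

definition P_positions :: "position set" where
  "P_positions = {(p1, p2, p3). (p1 XOR p2) XOR p3 = 0}"

fun counters :: "position \<Rightarrow> nat" where
  "counters (p1, p2, p3) = p1 + p2 + p3"

fun obtained_by_two_subtractions :: "position \<Rightarrow> position \<Rightarrow> bool" where
  "obtained_by_two_subtractions (p1, p2, p3) (q1, q2, q3) \<longleftrightarrow>
     (p1 + 1 = q1 \<and> p2 + 1 = q2 \<and> p3 = q3) \<or>
     (p1 + 1 = q1 \<and> p2 = q2 \<and> p3 + 1 = q3) \<or>
     (p1 = q1 \<and> p2 + 1 = q2 \<and> p3 + 1 = q3)"

definition nim_parent :: "position \<Rightarrow> position \<Rightarrow> bool" where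
  "nim_parent P Q \<longleftrightarrow>
     P \<in> P_positions \<and> Q \<in> P_positions \<and>
     counters P + 2 = counters Q \<and> obtained_by_two_subtractions P Q"

type_synonym cell = "int \<times> int"

definition forbidden :: "cell set" where
  "forbidden = {(x, y). y < 0 \<and> y \<le> - \<bar>x\<bar>}"

fun neighbors :: "cell \<Rightarrow> cell set" where
  "neighbors (x, y) = {(x + 1, y), (x - 1, y), (x, y + 1), (x, y - 1)}"

definition newborn :: "cell set \<Rightarrow> cell set" where
  "newborn A = {c. c \<notin> A \<and> c \<notin> forbidden \<and> (\<exists>!d. d \<in> neighbors c \<and> d \<in> A)}"

text \<open>The set \<open>alive n\<close> is cumulative: cells born in any generation up to \<open>n\<close>.\<close>

primrec alive :: "nat \<Rightarrow> cell set" where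
  "alive 0 = {(0, 0)}"
| "alive (Suc n) = alive n \<union> newborn (alive n)"

primrec born :: "nat \<Rightarrow> cell set" where
  "born 0 = {(0, 0)}"
| "born (Suc n) = newborn (alive n)"

definition automaton_cells :: "cell set" where
  "automaton_cells = (\<Union>n. alive n)"

text \<open>The parent must be alive just before the birth of \<open>d\<close>; neighbors of \<open>d\<close> that are born
  simultaneously with \<open>d\<close> or later are not parents.\<close>

definition automaton_parent :: "cell \<Rightarrow> cell \<Rightarrow> bool" where
  "automaton_parent c d \<longleftrightarrow> (\<exists>n. d \<in> born (Suc n) \<and> c \<in> neighbors d \<and> c \<in> alive n)"

end

theory Submission
  imports Defs
begin

text \<open>In binary, a P-position is a word over the four digits 000, 011, 101, 110, and its generation is
  the number whose binary ones mark the nonzero digits. Reading the word from the most significant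
  digit, let each nonzero digit of weight \<open>2\<^sup>k\<close> be a walk of length \<open>2\<^sup>k\<close> that goes straight on, turns
  left or turns right, where repeating the previous nonzero digit means going straight on. The
  parent of the word \<open>w X 0\<dots>0\<close> is \<open>w 0 X\<dots>X\<close>, whose walk is one step shorter in the same direction.
  Walks and automaton obey the same recursion: the cells of generation \<open>2 n\<close> are the doubles of those
  of generation \<open>n\<close>, and each of the latter, doubled, has a child in generation \<open>2 n + 1\<close> in the three
  directions other than the one to its parent.\<close>

subsection \<open>Self-similarity of the automaton\<close>

text \<open>A propositional birth condition, decidable by \<open>auto\<close> once the four
  memberships are rewritten.\<close>

lemma ex1_neighbors:
  "(\<exists>!d. d \<in> neighbors (x, y) \<and> d \<in> A) \<longleftrightarrow>
     ((x + 1, y) \<in> A \<and> (x - 1, y) \<notin> A \<and> (x, y + 1) \<notin> A \<and> (x, y - 1) \<notin> A) \<or>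
     ((x + 1, y) \<notin> A \<and> (x - 1, y) \<in> A \<and> (x, y + 1) \<notin> A \<and> (x, y - 1) \<notin> A) \<or>
     ((x + 1, y) \<notin> A \<and> (x - 1, y) \<notin> A \<and> (x, y + 1) \<in> A \<and> (x, y - 1) \<notin> A) \<or>
     ((x + 1, y) \<notin> A \<and> (x - 1, y) \<notin> A \<and> (x, y + 1) \<notin> A \<and> (x, y - 1) \<in> A)"
  (is "?l \<longleftrightarrow> ?r")
proof
  assume ?l
  then obtain d where d: "d \<in> neighbors (x, y)" "d \<in> A"
    and u: "\<And>d'. d' \<in> neighbors (x, y) \<Longrightarrow> d' \<in> A \<Longrightarrow> d' = d" by blast
  have "d = (x + 1, y) \<or> d = (x - 1, y) \<or> d = (x, y + 1) \<or> d = (x, y - 1)"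
    using d(1) by simp
  then show ?r
    using d(2) u[of "(x + 1, y)"] u[of "(x - 1, y)"] u[of "(x, y + 1)"] u[of "(x, y - 1)"]
    by (elim disjE) (simp_all, blast+)
next
  assume ?r
  then show ?l
  proof (elim disjE)
    assume "(x + 1, y) \<in> A \<and> (x - 1, y) \<notin> A \<and> (x, y + 1) \<notin> A \<and> (x, y - 1) \<notin> A"
    then show ?l by (intro ex1I[of _ "(x + 1, y)"]) auto
  next
    assume "(x + 1, y) \<notin> A \<and> (x - 1, y) \<in> A \<and> (x, y + 1) \<notin> A \<and> (x, y - 1) \<notin> A"
    then show ?l by (intro ex1I[of _ "(x - 1, y)"]) auto
  next
    assume "(x + 1, y) \<notin> A \<and> (x - 1, y) \<notin> A \<and> (x, y + 1) \<in> A \<and> (x, y - 1) \<notin> A"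
    then show ?l by (intro ex1I[of _ "(x, y + 1)"]) auto
  next
    assume "(x + 1, y) \<notin> A \<and> (x - 1, y) \<notin> A \<and> (x, y + 1) \<notin> A \<and> (x, y - 1) \<in> A"
    then show ?l by (intro ex1I[of _ "(x, y - 1)"]) auto
  qed
qed

section \<open>Generations and checkerboard parity\<close>

lemma newbornD: "c \<in> newborn A \<Longrightarrow> c \<notin> A \<and> c \<notin> forbidden"
  by (simp add: newborn_def)

lemma alive_mono: "m \<le> n \<Longrightarrow> alive m \<subseteq> alive n"
  by (rule lift_Suc_mono_le) auto

lemma alive_not_forbidden: "c \<in> alive n \<Longrightarrow> c \<notin> forbidden"
  by (induction n) (auto simp: newborn_def forbidden_def)

lemma origin_alive: "(0, 0) \<in> alive n"
  by (induction n) auto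

lemma born_Suc_iff: "c \<in> born (Suc n) \<longleftrightarrow> c \<in> alive (Suc n) \<and> c \<notin> alive n"
  by (auto simp: newborn_def)

lemma born_alive: "c \<in> born n \<Longrightarrow> c \<in> alive n"
  by (cases n) auto

lemma alive_born: "c \<in> alive n \<Longrightarrow> \<exists>m\<le>n. c \<in> born m"
proof (induction n)
  case (Suc n)
  then show ?case
    using born_Suc_iff[of c n] le_SucI by (cases "c \<in> alive n") blast+
qed auto

lemma born_disjoint: "c \<in> born m \<Longrightarrow> c \<in> born n \<Longrightarrow> m = n"
proof (induction m n rule: linorder_wlog)
  case (le m n)
  show ?case
  proof (rule ccontr)
    assume "m \<noteq> n"
    with le obtain k where k: "n = Suc k" "m \<le> k" by (cases n) auto
    have "c \<in> alive k" using born_alive[OF le(2)] alive_mono[OF k(2)] by blast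
    then show False using le(3) k(1) born_Suc_iff by blast
  qed
qed auto

text \<open>Had \<open>d\<close> been alive one generation earlier, it would already then have been
  the only alive neighbor of \<open>c\<close>, and \<open>c\<close> would have been born
  before.\<close>

lemma parent_born:
  assumes "c \<in> newborn (alive n)" "d \<in> neighbors c" "d \<in> alive n"
  shows "d \<in> born n"
proof (cases n)
  case (Suc m)
  have "d \<notin> alive m"
  proof
    assume d: "d \<in> alive m"
    have "c \<in> newborn (alive m)"
      using assms d unfolding newborn_def Suc by auto
    then show False using assms Suc by (auto simp: newborn_def)
  qed
  then show ?thesis using assms(3) Suc born_Suc_iff by blast
qed (use assms in auto)

text \<open>A birth is one step away from a cell of the preceding generation, so generations
  alternate between the two checkerboard colours. Hence cells of one generation are never
  adjacent.\<close>

lemma born_parity: "(x, y) \<in> born n \<Longrightarrow> even (x + y + int n)"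
proof (induction n arbitrary: x y)
  case (Suc n)
  then have nb: "(x, y) \<in> newborn (alive n)" by simp
  then obtain d where d: "d \<in> neighbors (x, y)" "d \<in> alive n" unfolding newborn_def by blast
  obtain u v where uv: "d = (u, v)" by fastforce
  have "even (u + v + int n)" using Suc.IH parent_born[OF nb d] uv by blast
  with d(1) uv show ?case by auto
qed auto

lemma born_neighbor:
  assumes "c \<in> born n" "d \<in> neighbors c"
  shows "d \<notin> born n"
proof -
  obtain x y u v where "c = (x, y)" "d = (u, v)" by fastforce
  with assms born_parity[of x y n] born_parity[of u v n] show ?thesis by auto
qed

text \<open>Doubling the lattice: cells with two even coordinates reproduce the automaton at half
  speed, cells with one odd coordinate are midpoints of lattice edges, and cells with two odd
  coordinates stay dead because their living neighbors come in simultaneous pairs. The midpoint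
  \<open>(0, -1)\<close> is the only forbidden one on an edge with an allowed endpoint.\<close>

definition refine :: "cell set \<Rightarrow> cell set \<Rightarrow> cell set" where
  "refine A B = {(u, v).
     (even u \<and> even v \<and> (u div 2, v div 2) \<in> A) \<or>
     (odd u \<and> even v \<and> ((u div 2, v div 2) \<in> B \<or> (u div 2 + 1, v div 2) \<in> B)) \<or>
     (even u \<and> odd v \<and> (u, v) \<noteq> (0, -1) \<and>
        ((u div 2, v div 2) \<in> B \<or> (u div 2, v div 2 + 1) \<in> B))}"

lemma refine_simps [simp]:
  "(2 * x, 2 * y) \<in> refine A B \<longleftrightarrow> (x, y) \<in> A"
  "(2 * x + 1, 2 * y) \<in> refine A B \<longleftrightarrow> (x, y) \<in> B \<or> (x + 1, y) \<in> B"
  "(2 * x - 1, 2 * y) \<in> refine A B \<longleftrightarrow> (x, y) \<in> B \<or> (x - 1, y) \<in> B"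
  "(2 * x, 2 * y + 1) \<in> refine A B \<longleftrightarrow>
     (x, y) \<noteq> (0, -1) \<and> ((x, y) \<in> B \<or> (x, y + 1) \<in> B)"
  "(2 * x, 2 * y - 1) \<in> refine A B \<longleftrightarrow>
     (x, y) \<noteq> (0, 0) \<and> ((x, y) \<in> B \<or> (x, y - 1) \<in> B)"
  "(2 * x + 1, 2 * y + 1) \<in> refine A B \<longleftrightarrow> False"
proof -
  have [simp]: "(2 * z - 1) div 2 = z - 1" for z :: int by presburger
  have [simp]: "2 * z - 1 = -1 \<longleftrightarrow> z = 0" "2 * z + 1 = -1 \<longleftrightarrow> z = -1" for z :: int
    by presburger+
  show "(2 * x, 2 * y) \<in> refine A B \<longleftrightarrow> (x, y) \<in> A"
    "(2 * x + 1, 2 * y) \<in> refine A B \<longleftrightarrow> (x, y) \<in> B \<or> (x + 1, y) \<in> B"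
    "(2 * x - 1, 2 * y) \<in> refine A B \<longleftrightarrow> (x, y) \<in> B \<or> (x - 1, y) \<in> B"
    "(2 * x, 2 * y + 1) \<in> refine A B \<longleftrightarrow>
       (x, y) \<noteq> (0, -1) \<and> ((x, y) \<in> B \<or> (x, y + 1) \<in> B)"
    "(2 * x, 2 * y - 1) \<in> refine A B \<longleftrightarrow>
       (x, y) \<noteq> (0, 0) \<and> ((x, y) \<in> B \<or> (x, y - 1) \<in> B)"
    "(2 * x + 1, 2 * y + 1) \<in> refine A B \<longleftrightarrow> False"
    by (auto simp: refine_def)
qed

lemma int_pair_parity_cases:
  fixes u v :: int
  obtains x y where "u = 2 * x" "v = 2 * y"
  | x y where "u = 2 * x + 1" "v = 2 * y"
  | x y where "u = 2 * x" "v = 2 * y + 1"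
  | x y where "u = 2 * x + 1" "v = 2 * y + 1"
  by (metis evenE oddE)

text \<open>The neighbors are the side midpoints of a doubled unit square. A corner in
  \<open>B\<close> lies on two sides, so the number of alive ones is never one. The missing midpoint
  \<open>(0, -1)\<close> only affects \<open>(1, -1)\<close> and \<open>(-1, -1)\<close>, which are
  forbidden.\<close>

lemma newborn_refine_odd_odd: "(2 * x + 1, 2 * y + 1) \<notin> newborn (refine A B)"
proof
  assume nb: "(2 * x + 1, 2 * y + 1) \<in> newborn (refine A B)"
  have n: "(2 * x + 1 + 1, 2 * y + 1) = (2 * (x + 1), 2 * y + 1)"
    "(2 * x + 1 - 1, 2 * y + 1) = (2 * x, 2 * y + 1)"
    "(2 * x + 1, 2 * y + 1 + 1) = (2 * x + 1, 2 * (y + 1))"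
    "(2 * x + 1, 2 * y + 1 - 1) = (2 * x + 1, 2 * y)"
    by simp_all
  have "(2 * x + 1, 2 * y + 1) \<notin> forbidden" using newbornD[OF nb] by blast
  then have "(x, y) \<noteq> (0, -1)" "(x, y) \<noteq> (-1, -1)" by (auto simp: forbidden_def)
  then have e: "(x + 1, y) \<noteq> (0, -1)" "(x, y) \<noteq> (0, -1)" by auto
  from nb show False
    unfolding newborn_def mem_Collect_eq ex1_neighbors n refine_simps
    using e by auto
qed

text \<open>Here \<open>B\<close> stands for the living set one generation before \<open>A\<close>.
  A dead allowed midpoint has at most one end in \<open>A\<close>, by \<open>indep\<close>, and is
  born if it has one. A doubled cell sees only midpoints next to \<open>B\<close>, so
  \<open>nb\<close> rules out its birth.\<close>

lemma refine_step_odd: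
  assumes sub: "B \<subseteq> A" and nb: "newborn B \<subseteq> A" and allowed: "A \<inter> forbidden = {}"
    and indep: "\<And>c d. c \<in> A - B \<Longrightarrow> d \<in> A - B \<Longrightarrow> d \<notin> neighbors c"
    and orig: "(0, 0) \<in> A"
  shows "refine A B \<union> newborn (refine A B) = refine A A"
proof -
  have ee: "(2 * x, 2 * y) \<notin> newborn (refine A B)" for x y
  proof
    assume a: "(2 * x, 2 * y) \<in> newborn (refine A B)"
    have c: "(x, y) \<notin> A" "(x, y) \<notin> B" using newbornD[OF a] sub by auto
    moreover have "(x, y) \<notin> forbidden" using newbornD[OF a] by (auto simp: forbidden_def)
    then have "(x, y) \<noteq> (0, -1)" by (auto simp: forbidden_def)
    moreover have "(x, y) \<noteq> (0, 0)" using c orig by auto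
    \<comment> \<open>Around a doubled cell outside \<open>B\<close>, a midpoint is alive iff the
      cell beyond it is in \<open>B\<close>. The exception \<open>(0, -1)\<close> lies only on the
      edge from \<open>(0, 0)\<close> to \<open>(0, -1)\<close>, and both ends have been
      excluded.\<close>
    ultimately have "(x, y) \<in> newborn B"
      using a \<open>(x, y) \<notin> forbidden\<close>
      unfolding newborn_def mem_Collect_eq ex1_neighbors refine_simps by auto
    then show False using c nb by blast
  qed
  have oe: "(2 * x + 1, 2 * y) \<in> refine A B \<or> (2 * x + 1, 2 * y) \<in> newborn (refine A B)
      \<longleftrightarrow> (x, y) \<in> A \<or> (x + 1, y) \<in> A" for x y
  proof -
    have n: "(2 * x + 1 + 1, 2 * y) = (2 * (x + 1), 2 * y)"
      "(2 * x + 1 - 1, 2 * y) = (2 * x, 2 * y)"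
      "(2 * x + 1, 2 * y - 1) = (2 * x + 1, 2 * (y - 1) + 1)"
      by simp_all
    \<comment> \<open>By parity the defining inequality is strict at a midpoint, so a forbidden
      midpoint has both ends forbidden.\<close>
    have "(2 * x + 1, 2 * y) \<notin> forbidden" if "(x, y) \<in> A \<or> (x + 1, y) \<in> A"
    proof -
      have "(x, y) \<notin> forbidden \<or> (x + 1, y) \<notin> forbidden" using that allowed by blast
      then show ?thesis by (auto simp: forbidden_def)
    qed
    moreover have "\<not> ((x, y) \<in> A - B \<and> (x + 1, y) \<in> A - B)"
      using indep[of "(x, y)" "(x + 1, y)"] by auto
    ultimately show ?thesis
      using sub
      unfolding newborn_def mem_Collect_eq ex1_neighbors n refine_simps by auto
  qed
  have eo: "(2 * x, 2 * y + 1) \<in> refine A B \<or> (2 * x, 2 * y + 1) \<in> newborn (refine A B)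
      \<longleftrightarrow> (x, y) \<noteq> (0, -1) \<and> ((x, y) \<in> A \<or> (x, y + 1) \<in> A)" for x y
  proof -
    have n: "(2 * x, 2 * y + 1 + 1) = (2 * x, 2 * (y + 1))"
      "(2 * x, 2 * y + 1 - 1) = (2 * x, 2 * y)"
      "(2 * x - 1, 2 * y + 1) = (2 * (x - 1) + 1, 2 * y + 1)"
      by simp_all
    \<comment> \<open>The same parity argument fails only at the tip of the region, where
      \<open>(0, -1)\<close> is forbidden but its end \<open>(0, 0)\<close> is not.\<close>
    have "(2 * x, 2 * y + 1) \<notin> forbidden"
      if "(x, y) \<noteq> (0, -1)" "(x, y) \<in> A \<or> (x, y + 1) \<in> A"
    proof -
      have "(x, y) \<notin> forbidden \<or> (x, y + 1) \<notin> forbidden" using that allowed by blast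
      then show ?thesis using that(1) by (auto simp: forbidden_def)
    qed
    moreover have "(2 * x, 2 * y + 1) \<in> forbidden" if "(x, y) = (0, -1)"
      using that by (auto simp: forbidden_def)
    moreover have "\<not> ((x, y) \<in> A - B \<and> (x, y + 1) \<in> A - B)"
      using indep[of "(x, y)" "(x, y + 1)"] by auto
    ultimately show ?thesis
      using sub
      unfolding newborn_def mem_Collect_eq ex1_neighbors n refine_simps by auto
  qed
  show ?thesis
  proof (rule set_eqI)
    fix c :: cell
    obtain u v where c: "c = (u, v)" by fastforce
    show "c \<in> refine A B \<union> newborn (refine A B) \<longleftrightarrow> c \<in> refine A A"
      unfolding c
      by (cases u v rule: int_pair_parity_cases)
        (use ee oe eo newborn_refine_odd_odd in auto)
  qed
qed

text \<open>Every allowed midpoint next to \<open>A\<close> is alive already, so no midpoint is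
  born, and the midpoints around a dead allowed doubled cell show exactly which neighbors are in
  \<open>A\<close>.\<close>

lemma refine_step_even:
  assumes orig: "(0, 0) \<in> A"
  shows "refine A A \<union> newborn (refine A A) = refine (A \<union> newborn A) A"
proof -
  have ee: "(2 * x, 2 * y) \<in> newborn (refine A A) \<longleftrightarrow> (x, y) \<in> newborn A" for x y
  proof (cases "(x, y) \<in> A \<or> (x, y) \<in> forbidden")
    case True
    then have "(x, y) \<in> A \<or> (2 * x, 2 * y) \<in> forbidden" by (auto simp: forbidden_def)
    with True show ?thesis
      using newbornD[of "(x, y)" A] newbornD[of "(2 * x, 2 * y)" "refine A A"] by auto
  next
    case False
    then have "(2 * x, 2 * y) \<notin> forbidden" by (auto simp: forbidden_def)
    moreover have "(x, y) \<noteq> (0, -1)" "(x, y) \<noteq> (0, 0)"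
      using False orig by (auto simp: forbidden_def)
    ultimately show ?thesis
      using False unfolding newborn_def mem_Collect_eq ex1_neighbors refine_simps by auto
  qed
  have oe: "(2 * x + 1, 2 * y) \<notin> newborn (refine A A)" for x y
  proof -
    have n: "(2 * x + 1 + 1, 2 * y) = (2 * (x + 1), 2 * y)"
      "(2 * x + 1 - 1, 2 * y) = (2 * x, 2 * y)"
      "(2 * x + 1, 2 * y - 1) = (2 * x + 1, 2 * (y - 1) + 1)"
      by simp_all
    show ?thesis
      unfolding newborn_def mem_Collect_eq ex1_neighbors n refine_simps by auto
  qed
  have eo: "(2 * x, 2 * y + 1) \<notin> newborn (refine A A)" for x y
  proof -
    have n: "(2 * x, 2 * y + 1 + 1) = (2 * x, 2 * (y + 1))"
      "(2 * x, 2 * y + 1 - 1) = (2 * x, 2 * y)"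
      "(2 * x - 1, 2 * y + 1) = (2 * (x - 1) + 1, 2 * y + 1)"
      by simp_all
    have "(2 * x, 2 * y + 1) \<in> forbidden" if "(x, y) = (0, -1)"
      using that by (auto simp: forbidden_def)
    then show ?thesis
      unfolding newborn_def mem_Collect_eq ex1_neighbors n refine_simps by auto
  qed
  show ?thesis
  proof (rule set_eqI)
    fix c :: cell
    obtain u v where c: "c = (u, v)" by fastforce
    show "c \<in> refine A A \<union> newborn (refine A A) \<longleftrightarrow> c \<in> refine (A \<union> newborn A) A"
      unfolding c
      by (cases u v rule: int_pair_parity_cases)
        (use ee oe eo newborn_refine_odd_odd in auto)
  qed
qed

text \<open>The two refinement steps alternate. At time \<open>2 * n\<close> the midpoints lag one
  generation behind; for \<open>n = 0\<close> there are none, whence the empty set in place of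
  \<open>alive (0 - 1)\<close>, which is \<open>alive 0\<close>.\<close>

lemma alive_double:
  "alive (2 * n) = refine (alive n) (if n = 0 then {} else alive (n - 1))" (is "?even n")
  "alive (2 * n + 1) = refine (alive n) (alive n)" (is "?odd n")
proof -
  have step: "?odd n" if "?even n" for n
  proof -
    let ?B = "if n = 0 then {} else alive (n - 1)"
    have diff: "alive n - ?B = born n"
      by (cases n) (auto simp: newborn_def)
    have "alive (2 * n + 1) = refine (alive n) ?B \<union> newborn (refine (alive n) ?B)"
      using that by simp
    also have "\<dots> = refine (alive n) (alive n)"
    proof (rule refine_step_odd)
      show "?B \<subseteq> alive n" using alive_mono[of "n - 1" n] by auto
      show "newborn ?B \<subseteq> alive n" by (cases n) (auto simp: newborn_def)
      show "alive n \<inter> forbidden = {}" using alive_not_forbidden by blast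
      show "d \<notin> neighbors c" if "c \<in> alive n - ?B" "d \<in> alive n - ?B" for c d
        using that born_neighbor unfolding diff by blast
    qed (rule origin_alive)
    finally show ?thesis .
  qed
  have even: "?even n" for n
  proof (induction n)
    case 0
    show ?case by (auto simp: refine_def elim!: evenE)
  next
    case (Suc n)
    have "alive (2 * Suc n) = alive (2 * n + 1) \<union> newborn (alive (2 * n + 1))" by simp
    also have "\<dots> = refine (alive (Suc n)) (alive n)"
      unfolding step[OF Suc] refine_step_even[OF origin_alive] by simp
    finally show ?case by simp
  qed
  show "?even n" "?odd n" using even step by blast+
qed

section \<open>Births in generations 2n and 2n + 1\<close>

definition dirs :: "cell set" where
  "dirs = {(1, 0), (-1, 0), (0, 1), (0, -1)}"

lemma neighbors_iff: "(u, v) \<in> neighbors (x, y) \<longleftrightarrow> (u - x, v - y) \<in> dirs"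
  by (auto simp: dirs_def)

text \<open>Two unit vectors are equal, opposite, or differ by odd coordinates. Thus doubled cells
  with a common neighboring midpoint are doubles of equal or adjacent cells.\<close>

lemma half_step:
  assumes "(a, b) \<in> dirs" "(c, d) \<in> dirs" "2 * u = a - c" "2 * v = b - d"
  shows "(u, v) = (0, 0) \<or> (u, v) \<in> dirs"
proof -
  have "(a, b) = (c, d) \<or> (a, b) = (- c, - d) \<or> odd (a - c)"
    using assms(1,2) unfolding dirs_def by (elim insertE emptyE) simp_all
  moreover have "even (a - c)" using assms(3) by (metis even_mult_iff even_numeral)
  ultimately consider "a = c" "b = d" | "a = - c" "b = - d" by auto
  then show ?thesis
  proof cases
    case 1
    with assms(3,4) show ?thesis by simp
  next
    case 2
    with assms(3,4) have "u = - c" "v = - d" by simp_all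
    with assms(2) show ?thesis unfolding dirs_def by (elim insertE emptyE) simp_all
  qed
qed

lemma midpoint_refine:
  "(a, b) \<in> dirs \<Longrightarrow> (2 * x + a, 2 * y + b) \<in> refine A B \<longleftrightarrow>
     (2 * x + a, 2 * y + b) \<noteq> (0, -1) \<and> ((x, y) \<in> B \<or> (x + a, y + b) \<in> B)"
  using refine_simps(5)[of 0 0 A B] by (auto simp: dirs_def) presburger+

text \<open>Births in generation \<open>n\<close> itself add no neighbor of \<open>c\<close>, by
  parity, so the uniqueness before the birth persists.\<close>

lemma unique_alive_neighbor:
  assumes "c \<in> born n" "d \<in> neighbors c" "d \<in> alive n" "d' \<in> neighbors c" "d' \<in> alive n"
  shows "d = d'"
proof (cases n)
  case 0
  with assms show ?thesis by auto
next
  case (Suc m)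
  have "d \<in> alive m" "d' \<in> alive m"
    using assms born_neighbor born_Suc_iff Suc by blast+
  moreover have "\<exists>!d. d \<in> neighbors c \<and> d \<in> alive m"
    using assms(1) Suc by (simp add: newborn_def)
  ultimately show ?thesis using assms by blast
qed

lemma born_double: "(2 * x, 2 * y) \<in> born (2 * n) \<longleftrightarrow> (x, y) \<in> born n"
proof (cases n)
  case (Suc m)
  have "2 * n = Suc (2 * m + 1)" using Suc by simp
  then have "(2 * x, 2 * y) \<in> born (2 * n) \<longleftrightarrow>
      (2 * x, 2 * y) \<in> alive (2 * n) \<and> (2 * x, 2 * y) \<notin> alive (2 * m + 1)"
    by (metis born_Suc_iff)
  also have "\<dots> \<longleftrightarrow> (x, y) \<in> alive n \<and> (x, y) \<notin> alive m"
    unfolding alive_double by simp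
  also have "\<dots> \<longleftrightarrow> (x, y) \<in> born n" unfolding Suc born_Suc_iff ..
  finally show ?thesis .
qed auto

text \<open>At time \<open>2 * n\<close> a midpoint is alive only if an end of its edge was alive
  before generation \<open>n\<close>, and neither end here is that old.\<close>

lemma born_midpoint:
  assumes "(a, b) \<in> dirs" "(x, y) \<in> born n" "(x + a, y + b) \<notin> alive n"
    "(2 * x + a, 2 * y + b) \<noteq> (0, -1)"
  shows "(2 * x + a, 2 * y + b) \<in> born (2 * n + 1)"
proof -
  have "(2 * x + a, 2 * y + b) \<in> alive (2 * n + 1)"
    unfolding alive_double midpoint_refine[OF assms(1)] using assms born_alive by blast
  moreover have "(2 * x + a, 2 * y + b) \<notin> alive (2 * n)"
  proof -
    have "(x, y) \<notin> alive (n - 1)" "(x + a, y + b) \<notin> alive (n - 1)" if "n > 0"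
      using that assms born_Suc_iff[of "(x, y)" "n - 1"] alive_mono[of "n - 1" n] by auto
    then show ?thesis
      unfolding alive_double midpoint_refine[OF assms(1)] by auto
  qed
  ultimately show ?thesis using born_Suc_iff by simp
qed

lemma born_odd_cases:
  assumes "c \<in> born (2 * n + 1)"
  obtains x y a b where "c = (2 * x + a, 2 * y + b)" "(a, b) \<in> dirs"
    "(x, y) \<in> born n" "(x + a, y + b) \<notin> alive n" "(2 * x + a, 2 * y + b) \<noteq> (0, -1)"
proof -
  note goal = that
  obtain u v where c: "c = (u, v)" by fastforce
  have al: "(u, v) \<in> alive (2 * n + 1)" and na: "(u, v) \<notin> alive (2 * n)"
    using assms c born_Suc_iff[of c "2 * n"] by auto
  have nf: "(u, v) \<noteq> (0, -1)" using alive_not_forbidden[OF al] by (auto simp: forbidden_def)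
  have key: thesis
    if e: "(u, v) = (2 * x + a, 2 * y + b)" and d: "(a, b) \<in> dirs" and xy: "(x, y) \<in> alive n"
    for x y a b
  proof -
    have "(2 * x + a, 2 * y + b) \<notin> alive (2 * n)" using na e by simp
    then have n1: "n > 0 \<Longrightarrow> (x, y) \<notin> alive (n - 1) \<and> (x + a, y + b) \<notin> alive (n - 1)"
      unfolding alive_double midpoint_refine[OF d] using e nf by auto
    have nbr: "(x + a, y + b) \<in> neighbors (x, y)" using d unfolding neighbors_iff by simp
    have new: "w \<in> born n" if "w \<in> alive n" "n > 0 \<Longrightarrow> w \<notin> alive (n - 1)" for w
      using that by (cases n) (auto simp: newborn_def)
    have b: "(x, y) \<in> born n" using new xy n1 by blast
    \<comment> \<open>The far end is dead: alive, it would also be born in generation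
      \<open>n\<close>, next to another cell of that generation.\<close>
    moreover have "(x + a, y + b) \<notin> alive n"
      using new[of "(x + a, y + b)"] n1 born_neighbor[OF b nbr] by blast
    ultimately show thesis using goal[of x a y b] e c d nf by simp
  qed
  show thesis
  proof (cases u v rule: int_pair_parity_cases)
    case (1 x y)
    with al na show ?thesis unfolding alive_double by simp
  next
    case (2 x y)
    with al have "(x, y) \<in> alive n \<or> (x + 1, y) \<in> alive n" unfolding alive_double by simp
    then show ?thesis
      using 2 key[of x 1 y 0] key[of "x + 1" "-1" y 0] by (auto simp: dirs_def)
  next
    case (3 x y)
    with al have "(x, y) \<in> alive n \<or> (x, y + 1) \<in> alive n" unfolding alive_double by simp
    then show ?thesis
      using 3 key[of x 0 y 1] key[of x 0 "y + 1" "-1"] by (auto simp: dirs_def)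
  next
    case (4 x y)
    with al show ?thesis unfolding alive_double by simp
  qed
qed

text \<open>The living sets at times \<open>2 * n - 1\<close> and \<open>2 * n\<close> have the same
  midpoints, so only doubled cells are new.\<close>

lemma born_even_cases:
  assumes "c \<in> born (2 * n)" "n > 0"
  obtains x y where "c = (2 * x, 2 * y)" "(x, y) \<in> born n"
proof -
  obtain m where m: "n = Suc m" using assms(2) by (cases n) auto
  obtain u v where c: "c = (u, v)" by fastforce
  have "2 * n = Suc (2 * m + 1)" using m by simp
  then have "(u, v) \<in> alive (2 * n)" "(u, v) \<notin> alive (2 * m + 1)"
    using assms c by (metis born_Suc_iff)+
  then have al: "(u, v) \<in> refine (alive n) (alive m)"
    and na: "(u, v) \<notin> refine (alive m) (alive m)"
    unfolding alive_double using m by simp_all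
  show thesis
  proof (cases u v rule: int_pair_parity_cases)
    case (1 x y)
    with assms that c born_double show ?thesis by metis
  qed (use al na in auto)
qed

subsection \<open>Binary digits of Nim positions\<close>

text \<open>Besides being the nonzero digits, these are the differences between a child and its
  parent.\<close>

definition masks :: "position set" where
  "masks = {(0, 1, 1), (1, 0, 1), (1, 1, 0)}"

abbreviation digits :: "position set" where
  "digits \<equiv> insert (0, 0, 0) masks"

fun append_digit :: "position \<Rightarrow> position \<Rightarrow> position" where
  "append_digit (p1, p2, p3) (x1, x2, x3) = (2 * p1 + x1, 2 * p2 + x2, 2 * p3 + x3)"

text \<open>Bitwise XOR commutes with halving, and its lowest bit is the parity of the sum.\<close>

lemma P_positions_halve:
  "(p1, p2, p3) \<in> P_positions \<longleftrightarrow>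
     even (p1 + p2 + p3) \<and> (p1 div 2, p2 div 2, p3 div 2) \<in> P_positions"
proof -
  have "n = 0 \<longleftrightarrow> even n \<and> n div 2 = 0" for n :: nat by auto
  moreover have "((p1 XOR p2) XOR p3) div 2 = ((p1 div 2) XOR (p2 div 2)) XOR (p3 div 2)"
    using drop_bit_xor[of 1 "p1 XOR p2" p3] drop_bit_xor[of 1 p1 p2]
    by (simp add: drop_bit_eq_div)
  moreover have "even ((p1 XOR p2) XOR p3) \<longleftrightarrow> even (p1 + p2 + p3)"
    by (auto simp: even_xor_iff)
  ultimately show ?thesis
    unfolding P_positions_def mem_Collect_eq prod.case by metis
qed

lemma zero_P_position: "(0, 0, 0) \<in> P_positions"
  by (simp add: P_positions_def)

lemma even_counters:
  assumes "P \<in> P_positions"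
  shows "even (counters P)"
proof -
  obtain p1 p2 p3 where P: "P = (p1, p2, p3)" by (cases P) auto
  show ?thesis using assms P_positions_halve[of p1 p2 p3] unfolding P counters.simps by blast
qed

lemma append_digit_P_position:
  assumes "X \<in> digits"
  shows "append_digit Q X \<in> P_positions \<longleftrightarrow> Q \<in> P_positions"
proof -
  obtain q1 q2 q3 x1 x2 x3 where Q: "Q = (q1, q2, q3)" and X: "X = (x1, x2, x3)"
    by (cases Q; cases X) auto
  have "even (x1 + x2 + x3)" "x1 \<le> 1" "x2 \<le> 1" "x3 \<le> 1"
    using assms unfolding X by (auto simp: masks_def)
  moreover have "(2 * q + x) div 2 = q" if "x \<le> 1" for q x :: nat using that by simp
  ultimately show ?thesis
    unfolding Q X append_digit.simps
      P_positions_halve[of "2 * q1 + x1" "2 * q2 + x2" "2 * q3 + x3"] by simp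
qed

lemma digitsI:
  assumes "x1 < 2" "x2 < 2" "x3 < 2" "even (x1 + x2 + x3)"
  shows "(x1, x2, x3) \<in> digits"
proof -
  have "x1 = 0 \<or> x1 = 1" "x2 = 0 \<or> x2 = 1" "x3 = 0 \<or> x3 = 1" using assms by linarith+
  then show ?thesis using assms(4) unfolding masks_def by (elim disjE) simp_all
qed

lemma P_position_cases:
  assumes "P \<in> P_positions"
  obtains Q X where "Q \<in> P_positions" "X \<in> digits" "P = append_digit Q X"
proof -
  obtain p1 p2 p3 where P: "P = (p1, p2, p3)" by (cases P) auto
  let ?Q = "(p1 div 2, p2 div 2, p3 div 2)" and ?X = "(p1 mod 2, p2 mod 2, p3 mod 2)"
  have even: "even (p1 + p2 + p3)" and Q: "?Q \<in> P_positions"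
    using assms P_positions_halve unfolding P by blast+
  have "even (p1 mod 2 + p2 mod 2 + p3 mod 2)" using even by simp
  then have X: "?X \<in> digits" by (intro digitsI) simp_all
  have "P = append_digit ?Q ?X" unfolding P by simp
  then show thesis by (rule that[OF Q X])
qed

text \<open>Induction along the binary word from its most significant digit. Excluding a zero digit
  after the zero position makes the number of counters grow at each step.\<close>

lemma P_position_induct [consumes 1, case_names zero digit]:
  assumes "P \<in> P_positions" "R (0, 0, 0)"
    "\<And>Q X. Q \<in> P_positions \<Longrightarrow> X \<in> digits \<Longrightarrow> Q \<noteq> (0, 0, 0) \<or> X \<noteq> (0, 0, 0) \<Longrightarrow> R Q \<Longrightarrow>
       R (append_digit Q X)"
  shows "R P"
  using assms(1)
proof (induction "counters P" arbitrary: P rule: less_induct)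
  case less
  obtain Q X where QX: "Q \<in> P_positions" "X \<in> digits" "P = append_digit Q X"
    using P_position_cases[OF less.prems] .
  show ?case
  proof (cases "Q = (0, 0, 0) \<and> X = (0, 0, 0)")
    case True
    with QX assms(2) show ?thesis by simp
  next
    case False
    then have "counters Q < counters P"
      using QX by (cases Q; cases X) (auto simp: masks_def)
    with less.hyps QX False assms(3) show ?thesis by blast
  qed
qed

section \<open>Parents in terms of binary words\<close>

fun pos_add :: "position \<Rightarrow> position \<Rightarrow> position" where
  "pos_add (p1, p2, p3) (x1, x2, x3) = (p1 + x1, p2 + x2, p3 + x3)"

lemma nim_parent_iff:
  "nim_parent P Q \<longleftrightarrow>
     P \<in> P_positions \<and> Q \<in> P_positions \<and> (\<exists>M\<in>masks. Q = pos_add P M)"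
  by (cases P; cases Q) (auto simp: nim_parent_def masks_def)

text \<open>If two different nonzero digits were involved, \<open>Q\<close> and \<open>R\<close> would differ in a single counter,
  which the parity of their sums excludes.\<close>

lemma append_digit_eq_pos_add:
  assumes "append_digit Q X = pos_add (append_digit R Y) M"
    and "Q \<in> P_positions" "R \<in> P_positions" "X \<in> digits" "Y \<in> digits" "M \<in> masks"
  shows "X = M \<and> Y = (0, 0, 0) \<and> R = Q \<or> X = (0, 0, 0) \<and> Y = M \<and> Q = pos_add R M"
proof -
  obtain q1 q2 q3 r1 r2 r3 where QR: "Q = (q1, q2, q3)" "R = (r1, r2, r3)"
    by (cases Q; cases R) auto
  obtain x1 x2 x3 y1 y2 y3 m1 m2 m3
    where XYM: "X = (x1, x2, x3)" "Y = (y1, y2, y3)" "M = (m1, m2, m3)"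
    by (cases X; cases Y; cases M) auto
  have X: "x1 \<le> 1" "x2 \<le> 1" "x3 \<le> 1" "even (x1 + x2 + x3)"
    and Y: "y1 \<le> 1" "y2 \<le> 1" "y3 \<le> 1" "even (y1 + y2 + y3)"
    and M: "m1 = 0 \<and> m2 = 1 \<and> m3 = 1 \<or> m1 = 1 \<and> m2 = 0 \<and> m3 = 1 \<or> m1 = 1 \<and> m2 = 1 \<and> m3 = 0"
    using assms(4-6) unfolding XYM masks_def by auto
  have e: "2 * q1 + x1 = 2 * r1 + y1 + m1" "2 * q2 + x2 = 2 * r2 + y2 + m2"
    "2 * q3 + x3 = 2 * r3 + y3 + m3"
    using assms(1) unfolding QR XYM by auto
  have even: "even (q1 + q2 + q3)" "even (r1 + r2 + r3)"
    using even_counters[OF assms(2)] even_counters[OF assms(3)] QR by auto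
  have zero: "x = y \<and> q = r" if "2 * q + x = 2 * r + y + 0" "x \<le> 1" "y \<le> 1" for q r x y :: nat
    using that by presburger
  have one: "x = 1 \<and> y = 0 \<and> q = r \<or> x = 0 \<and> y = 1 \<and> q = r + 1"
    if "2 * q + x = 2 * r + y + 1" "x \<le> 1" "y \<le> 1" for q r x y :: nat
    using that by presburger
  have even_le_1: "n = 0" if "even n" "n \<le> Suc 0" for n :: nat using that by presburger
  from M consider "m1 = 0" "m2 = 1" "m3 = 1" | "m1 = 1" "m2 = 0" "m3 = 1"
    | "m1 = 1" "m2 = 1" "m3 = 0" by blast
  then show ?thesis
  proof cases
    case 1
    have "x1 = y1 \<and> q1 = r1" using zero[OF e(1)[unfolded 1] X(1) Y(1)] .
    moreover have "x2 = 1 \<and> y2 = 0 \<and> q2 = r2 \<or> x2 = 0 \<and> y2 = 1 \<and> q2 = r2 + 1"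
      using one[OF e(2)[unfolded 1] X(2) Y(2)] .
    moreover have "x3 = 1 \<and> y3 = 0 \<and> q3 = r3 \<or> x3 = 0 \<and> y3 = 1 \<and> q3 = r3 + 1"
      using one[OF e(3)[unfolded 1] X(3) Y(3)] .
    ultimately have "x1 = 0 \<and> y1 = 0 \<and> q1 = r1 \<and>
      (x2 = 1 \<and> x3 = 1 \<and> y2 = 0 \<and> y3 = 0 \<and> q2 = r2 \<and> q3 = r3 \<or>
       x2 = 0 \<and> x3 = 0 \<and> y2 = 1 \<and> y3 = 1 \<and> q2 = r2 + 1 \<and> q3 = r3 + 1)"
      using X(4,1) even by (elim disjE conjE) (simp_all add: even_le_1)
    with 1 show ?thesis unfolding QR XYM by auto
  next
    case 2
    have "x2 = y2 \<and> q2 = r2" using zero[OF e(2)[unfolded 2] X(2) Y(2)] .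
    moreover have "x1 = 1 \<and> y1 = 0 \<and> q1 = r1 \<or> x1 = 0 \<and> y1 = 1 \<and> q1 = r1 + 1"
      using one[OF e(1)[unfolded 2] X(1) Y(1)] .
    moreover have "x3 = 1 \<and> y3 = 0 \<and> q3 = r3 \<or> x3 = 0 \<and> y3 = 1 \<and> q3 = r3 + 1"
      using one[OF e(3)[unfolded 2] X(3) Y(3)] .
    ultimately have "x2 = 0 \<and> y2 = 0 \<and> q2 = r2 \<and>
      (x1 = 1 \<and> x3 = 1 \<and> y1 = 0 \<and> y3 = 0 \<and> q1 = r1 \<and> q3 = r3 \<or>
       x1 = 0 \<and> x3 = 0 \<and> y1 = 1 \<and> y3 = 1 \<and> q1 = r1 + 1 \<and> q3 = r3 + 1)"
      using X(4,2) even by (elim disjE conjE) (simp_all add: even_le_1)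
    with 2 show ?thesis unfolding QR XYM by auto
  next
    case 3
    have "x3 = y3 \<and> q3 = r3" using zero[OF e(3)[unfolded 3] X(3) Y(3)] .
    moreover have "x1 = 1 \<and> y1 = 0 \<and> q1 = r1 \<or> x1 = 0 \<and> y1 = 1 \<and> q1 = r1 + 1"
      using one[OF e(1)[unfolded 3] X(1) Y(1)] .
    moreover have "x2 = 1 \<and> y2 = 0 \<and> q2 = r2 \<or> x2 = 0 \<and> y2 = 1 \<and> q2 = r2 + 1"
      using one[OF e(2)[unfolded 3] X(2) Y(2)] .
    ultimately have "x3 = 0 \<and> y3 = 0 \<and> q3 = r3 \<and>
      (x1 = 1 \<and> x2 = 1 \<and> y1 = 0 \<and> y2 = 0 \<and> q1 = r1 \<and> q2 = r2 \<or>
       x1 = 0 \<and> x2 = 0 \<and> y1 = 1 \<and> y2 = 1 \<and> q1 = r1 + 1 \<and> q2 = r2 + 1)"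
      using X(4,3) even by (elim disjE conjE) (simp_all add: even_le_1)
    with 3 show ?thesis unfolding QR XYM by auto
  qed
qed

lemma nim_parent_exists:
  assumes "Q \<in> P_positions" "Q \<noteq> (0, 0, 0)"
  shows "\<exists>P. nim_parent P Q"
  using assms
proof (induction Q rule: P_position_induct)
  case (digit Q X)
  show ?case
  proof (cases "X = (0, 0, 0)")
    case True
    with digit obtain P M where P: "P \<in> P_positions" "M \<in> masks" "Q = pos_add P M"
      unfolding nim_parent_iff by blast
    \<comment> \<open>Pilewise, doubling \<open>P + M\<close> gives \<open>(2 * P + M) + M\<close>:
      half of the doubled mask becomes the last digit of the parent.\<close>
    have "append_digit Q X = pos_add (append_digit P M) M"
      unfolding True P(3) by (cases P; cases M) simp
    then show ?thesis
      unfolding nim_parent_iff using P digit append_digit_P_position by blast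
  next
    case False
    have "append_digit Q X = pos_add (append_digit Q (0, 0, 0)) X"
      by (cases Q; cases X) simp
    then show ?thesis
      unfolding nim_parent_iff using False digit append_digit_P_position by blast
  qed
qed simp

subsection \<open>The isomorphism\<close>

text \<open>The mask \<open>L\<close> is the most recent nonzero digit: repeating it means going straight on, and the
  two other digits mean turning left or right.\<close>

fun turn :: "position \<Rightarrow> cell \<Rightarrow> position \<Rightarrow> cell" where
  "turn (l1, l2, l3) (a, b) X =
     (if X = (l1, l2, l3) then (a, b) else if X = (l3, l1, l2) then (- b, a) else (b, - a))"

lemma turn_same [simp]: "turn L e L = e"
  by (cases L; cases e) simp

lemma turn_cases: "turn L (a, b) X \<in> {(a, b), (- b, a), (b, - a)}"
  by (cases L) (simp only: turn.simps split: if_split, blast)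

lemma turn_dirs:
  assumes "e \<in> dirs"
  shows "turn L e X \<in> dirs"
proof -
  obtain a b where "e = (a, b)" by fastforce
  with assms turn_cases[of L a b X] show ?thesis by (auto simp: dirs_def)
qed

lemma turn_not_back: "(a, b) \<in> dirs \<Longrightarrow> turn L (a, b) X \<noteq> (- a, - b)"
  using turn_cases[of L a b X] by (auto simp: dirs_def)

text \<open>The cyclic shift of a mask is another mask, so the three masks select straight on, left
  and right once each.\<close>

lemma turn_inject:
  "L \<in> masks \<Longrightarrow> X \<in> masks \<Longrightarrow> Y \<in> masks \<Longrightarrow> e \<in> dirs \<Longrightarrow> turn L e X = turn L e Y \<Longrightarrow> X = Y"
  unfolding masks_def dirs_def by (elim insertE emptyE) simp_all

lemma turn_surj:
  "L \<in> masks \<Longrightarrow> (a, b) \<in> dirs \<Longrightarrow> d \<in> dirs \<Longrightarrow> d \<noteq> (- a, - b) \<Longrightarrow>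
     \<exists>X\<in>masks. turn L (a, b) X = d"
  unfolding masks_def dirs_def by (elim insertE emptyE) simp_all

text \<open>A new lowest digit doubles the weights of all earlier ones, hence the walk so far. Mask
  and direction outlast zero digits.\<close>

fun advance :: "position \<times> cell \<times> cell \<Rightarrow> position \<Rightarrow> position \<times> cell \<times> cell" where
  "advance (L, e, x, y) X =
     (if X = (0, 0, 0) then (L, e, 2 * x, 2 * y)
      else (X, turn L e X, 2 * x + fst (turn L e X), 2 * y + snd (turn L e X)))"

text \<open>The components of the result are the lowest nonzero digit, the direction in which the cell
  is entered, and the cell. The values at the zero position make \<open>(0, -1)\<close>, which is forbidden, play
  the part of the parent of the origin.\<close>

function trace :: "position \<Rightarrow> position \<times> cell \<times> cell" where
  "trace (p1, p2, p3) =
     (if (p1, p2, p3) = (0, 0, 0) then ((0, 1, 1), (0, 1), (0, 0))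
      else advance (trace (p1 div 2, p2 div 2, p3 div 2)) (p1 mod 2, p2 mod 2, p3 mod 2))"
  by pat_completeness auto
termination
proof (relation "measure counters")
  fix p1 p2 p3 :: nat
  assume nz: "(p1, p2, p3) \<noteq> (0, 0, 0)"
  have half: "n = 0 \<or> n div 2 < n" for n :: nat by auto
  show "((p1 div 2, p2 div 2, p3 div 2), (p1, p2, p3)) \<in> measure counters"
    using nz half[of p1] half[of p2] half[of p3] by auto
qed simp

declare trace.simps [simp del]

lemma trace_zero: "trace (0, 0, 0) = ((0, 1, 1), (0, 1), (0, 0))"
  by (simp add: trace.simps)

text \<open>For the zero position the recursion stops, but its initial values are fixed by appending
  a zero digit.\<close>

lemma trace_append_digit:
  assumes "X \<in> digits"
  shows "trace (append_digit Q X) = advance (trace Q) X"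
proof (cases "append_digit Q X = (0, 0, 0)")
  case True
  then have "Q = (0, 0, 0)" "X = (0, 0, 0)" by (cases Q; cases X; simp)+
  then show ?thesis by (simp add: trace_zero)
next
  case False
  obtain q1 q2 q3 x1 x2 x3 where Q: "Q = (q1, q2, q3)" and X: "X = (x1, x2, x3)"
    by (cases Q; cases X) auto
  have "x1 \<le> 1" "x2 \<le> 1" "x3 \<le> 1"
    using assms unfolding X by (auto simp: masks_def)
  moreover have "(2 * q + x) div 2 = q \<and> (2 * q + x) mod 2 = x" if "x \<le> 1" for q x :: nat
    using that by simp
  ultimately show ?thesis
    using False unfolding Q X append_digit.simps
      trace.simps[of "2 * q1 + x1" "2 * q2 + x2" "2 * q3 + x3"] by (simp only: if_False)
qed

abbreviation cell_of :: "position \<Rightarrow> cell" where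
  "cell_of P \<equiv> snd (snd (trace P))"

text \<open>Clearing a nonzero last digit undoes the last unit step. With a trailing zero, that step
  is doubled, and the last digit \<open>M\<close> of the parent walks its first half. This requires
  \<open>M\<close> to turn in the direction of that step, hence the claim about \<open>turn\<close>
  in the induction.\<close>

lemma trace_parent:
  assumes "Q \<in> P_positions" "P \<in> P_positions" "M \<in> masks" "Q = pos_add P M"
    and "trace Q = (L, (a, b), (x, y))" "trace P = (L', e', (x', y'))"
  shows "L = M \<and> turn L' e' M = (a, b) \<and> x' = x - a \<and> y' = y - b"
  using assms
proof (induction Q arbitrary: P L a b x y L' e' x' y' rule: P_position_induct)
  case zero
  then show ?case by (cases P) (auto simp: masks_def)
next
  case (digit Q X)
  obtain R Y where R: "R \<in> P_positions" "Y \<in> digits" "P = append_digit R Y"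
    using P_position_cases digit.prems(1) by blast
  obtain L0 a0 b0 x0 y0 where Q: "trace Q = (L0, (a0, b0), (x0, y0))" by (cases "trace Q") auto
  obtain L1 e1 x1 y1 where R1: "trace R = (L1, e1, (x1, y1))" by (cases "trace R") auto
  have nz: "M \<noteq> (0, 0, 0)" using digit.prems(2) by (auto simp: masks_def)
  note tr = digit.prems(4)[unfolded trace_append_digit[OF digit.hyps(2)] Q]
    digit.prems(5)[unfolded R(3) trace_append_digit[OF R(2)] R1]
  consider "X = M" "Y = (0, 0, 0)" "R = Q"
    | "X = (0, 0, 0)" "Y = M" "Q = pos_add R M"
    using append_digit_eq_pos_add[of Q X R Y M] digit.hyps digit.prems R by blast
  then show ?case
  proof cases
    case 1
    have Qs: "L1 = L0" "e1 = (a0, b0)" "x1 = x0" "y1 = y0"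
      using Q R1 unfolding 1(3) by simp_all
    obtain c d where cd: "turn L0 (a0, b0) M = (c, d)" by fastforce
    have "L = M" "a = c" "b = d" "x = 2 * x0 + c" "y = 2 * y0 + d"
      using tr(1) nz cd unfolding 1(1) by simp_all
    moreover have "L' = L0" "e' = (a0, b0)" "x' = 2 * x0" "y' = 2 * y0"
      using tr(2) Qs unfolding 1(2) by simp_all
    ultimately show ?thesis using cd by simp
  next
    case 2
    have "L0 = M \<and> turn L1 e1 M = (a0, b0) \<and> x1 = x0 - a0 \<and> y1 = y0 - b0"
      using digit.IH[OF R(1) digit.prems(2) 2(3) Q R1] .
    then have IH: "L0 = M" "turn L1 e1 M = (a0, b0)" "x1 = x0 - a0" "y1 = y0 - b0"
      by blast+
    have "L = M" "a = a0" "b = b0" "x = 2 * x0" "y = 2 * y0"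
      using tr(1) IH(1) unfolding 2(1) by simp_all
    moreover have "L' = M" "e' = (a0, b0)" "x' = 2 * (x0 - a0) + a0" "y' = 2 * (y0 - b0) + b0"
      using tr(2) nz IH(2-4) unfolding 2(2) by simp_all
    ultimately show ?thesis by simp
  qed
qed

text \<open>Tracking the parent as the cell behind shows that all other directions lead to dead
  cells, so the midpoints there can be born.\<close>

lemma trace_born:
  assumes "P \<in> P_positions" "trace P = (L, (a, b), (x, y))" "counters P = 2 * n"
  shows "L \<in> masks \<and> (a, b) \<in> dirs \<and> (x, y) \<in> born n \<and>
    (if P = (0, 0, 0) then (a, b) = (0, 1) else n > 0 \<and> (x - a, y - b) \<in> alive (n - 1))"
  using assms
proof (induction P arbitrary: L a b x y n rule: P_position_induct)
  case zero
  then show ?case by (auto simp: trace_zero masks_def dirs_def)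
next
  case (digit Q X)
  obtain L0 a0 b0 x0 y0 where Q: "trace Q = (L0, (a0, b0), (x0, y0))" by (cases "trace Q") auto
  obtain m where m: "counters Q = 2 * m" using even_counters[OF digit.hyps(1)] by blast
  note IH = digit.IH[OF Q m]
  note tr = digit.prems(1)[unfolded trace_append_digit[OF digit.hyps(2)] Q]
  have nonzero: "append_digit Q X \<noteq> (0, 0, 0)"
    using digit.hyps by (cases Q; cases X) auto
  show ?case
  proof (cases "X = (0, 0, 0)")
    case True
    then have [simp]: "L = L0" "a = a0" "b = b0" "x = 2 * x0" "y = 2 * y0" using tr by auto
    have Q0: "Q \<noteq> (0, 0, 0)" using True digit.hyps by auto
    have n: "n = 2 * m" using digit.prems(2) m unfolding True by (cases Q) auto
    have m0: "m > 0" and par: "(x0 - a0, y0 - b0) \<in> alive (m - 1)" using IH Q0 by auto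
    \<comment> \<open>The new cell behind is the midpoint of the doubled edge to the parent, alive
      at time \<open>2 * m - 1\<close>.\<close>
    have dir: "(- a0, - b0) \<in> dirs" using IH by (auto simp: dirs_def)
    have born: "(2 * x0, 2 * y0) \<in> born n" using IH born_double n by blast
    have "(x0, y0) \<in> alive m" using IH born_alive by blast
    then have "(x0, y0) \<notin> forbidden" by (rule alive_not_forbidden)
    then have "(x0, y0) \<noteq> (0, -1)" by (auto simp: forbidden_def)
    moreover have "(x0, y0) \<noteq> (0, 0)"
      using IH m0 born_disjoint[of "(0, 0)" 0 m] by auto
    ultimately have "(2 * x0 + - a0, 2 * y0 + - b0) \<noteq> (0, -1)"
      using dir by (auto simp: dirs_def)
    then have "(2 * x0 + - a0, 2 * y0 + - b0) \<in> alive (2 * (m - 1) + 1)"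
      unfolding alive_double midpoint_refine[OF dir] using par by auto
    moreover have "2 * (m - 1) + 1 = n - 1" using n m0 by simp
    ultimately have "(x - a, y - b) \<in> alive (n - 1)" by (simp del: alive.simps)
    then show ?thesis using IH born nonzero n m0 by (simp del: alive.simps)
  next
    case False
    define c d where "c = fst (turn L0 (a0, b0) X)" and "d = snd (turn L0 (a0, b0) X)"
    then have cd: "turn L0 (a0, b0) X = (c, d)" by simp
    then have [simp]: "L = X" "a = c" "b = d" "x = 2 * x0 + c" "y = 2 * y0 + d"
      using tr False by auto
    have n: "n = 2 * m + 1"
      using digit.prems(2) digit.hyps(2) m False by (cases Q) (auto simp: masks_def)
    have dir: "(c, d) \<in> dirs" and nb: "(c, d) \<noteq> (- a0, - b0)"
      using IH turn_dirs[of "(a0, b0)" L0 X] turn_not_back[of a0 b0 L0 X] cd by auto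
    have b0: "(x0, y0) \<in> born m" using IH by blast
    \<comment> \<open>A living cell ahead would be a second alive neighbor beside the one behind;
      for zero \<open>Q\<close> only the origin is alive.\<close>
    have "(x0 + c, y0 + d) \<notin> alive m"
    proof
      assume al: "(x0 + c, y0 + d) \<in> alive m"
      have nbr: "(x0 + c, y0 + d) \<in> neighbors (x0, y0)" using dir unfolding neighbors_iff by simp
      show False
      proof (cases "Q = (0, 0, 0)")
        case True
        with m b0 al dir show False by (auto simp: dirs_def)
      next
        case False
        then have "(x0 - a0, y0 - b0) \<in> alive m"
          using IH alive_mono[of "m - 1" m] by auto
        moreover have "(x0 - a0, y0 - b0) \<in> neighbors (x0, y0)"
          using IH unfolding neighbors_iff by (auto simp: dirs_def)
        ultimately have "(x0 + c, y0 + d) = (x0 - a0, y0 - b0)"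
          using unique_alive_neighbor[OF b0 nbr al] by blast
        then show False using nb by simp
      qed
    qed
    \<comment> \<open>The missing midpoint would require a step down from the origin, which is
      backward for the initial direction \<open>(0, 1)\<close>.\<close>
    moreover have "(2 * x0 + c, 2 * y0 + d) \<noteq> (0, -1)"
    proof
      assume e: "(2 * x0 + c, 2 * y0 + d) = (0, -1)"
      have "(x0, y0) \<noteq> (0, -1)"
        using alive_not_forbidden[OF born_alive[OF b0]] by (auto simp: forbidden_def)
      with e dir have z: "(x0, y0) = (0, 0)" "(c, d) = (0, -1)" by (auto simp: dirs_def)
      then have "m = 0" using b0 born_disjoint[of "(0, 0)" 0 m] by auto
      then have "Q = (0, 0, 0)" using m by (cases Q) auto
      then show False using IH nb z by simp
    qed
    ultimately have "(x, y) \<in> born n"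
      using born_midpoint[OF dir b0] n by simp
    moreover have "(2 * x0, 2 * y0) \<in> alive (2 * m)"
      using born_alive[OF b0] unfolding alive_double by simp
    ultimately show ?thesis
      using dir nonzero n False digit.hyps(2) by (simp del: alive.simps born.simps)
  qed
qed

section \<open>Bijectivity of the map from positions to cells\<close>

lemma cell_of_born:
  assumes "P \<in> P_positions" "counters P = 2 * n"
  shows "cell_of P \<in> born n"
  using trace_born[OF assms(1) _ assms(2)] by (cases "trace P") auto

text \<open>Equal cells have equal generations, whose parity tells whether the last digit is
  nonzero. So both last digits vanish or neither does, and the rest of the word and then the last
  digit can be recovered from the cell.\<close>

lemma cell_of_inj:
  assumes "P \<in> P_positions" "P' \<in> P_positions" "cell_of P = cell_of P'"
  shows "P = P'"
  using assms
proof (induction P arbitrary: P' rule: P_position_induct)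
  case zero
  obtain n where n: "counters P' = 2 * n" using even_counters[OF zero(1)] by blast
  have "n = 0"
    using cell_of_born[OF zero(1) n] zero(2) born_disjoint[of "(0, 0)" 0 n]
    by (auto simp: trace_zero)
  with n show ?case by (cases P') auto
next
  case (digit Q X)
  obtain R Y where R: "R \<in> P_positions" "Y \<in> digits" "P' = append_digit R Y"
    using P_position_cases digit.prems(1) by blast
  obtain L0 a0 b0 x0 y0 where Q: "trace Q = (L0, (a0, b0), (x0, y0))" by (cases "trace Q") auto
  obtain L1 a1 b1 x1 y1 where R1: "trace R = (L1, (a1, b1), (x1, y1))" by (cases "trace R") auto
  obtain m where m: "counters Q = 2 * m" using even_counters[OF digit.hyps(1)] by blast
  obtain k where k: "counters R = 2 * k" using even_counters[OF R(1)] by blast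
  define i j where "i = (if X = (0, 0, 0) then 0 else 1 :: nat)"
    and "j = (if Y = (0, 0, 0) then 0 else 1 :: nat)"
  have cQ: "counters (append_digit Q X) = 2 * (2 * m + i)"
    using digit.hyps(2) m by (cases Q) (auto simp: masks_def i_def)
  have cR: "counters (append_digit R Y) = 2 * (2 * k + j)"
    using R(2) k by (cases R) (auto simp: masks_def j_def)
  have "append_digit Q X \<in> P_positions" "append_digit R Y \<in> P_positions"
    using digit R append_digit_P_position by blast+
  then have "2 * m + i = 2 * k + j"
    using cell_of_born[OF _ cQ] cell_of_born[OF _ cR] digit.prems(2) R(3) born_disjoint by metis
  moreover have "i \<le> 1" "j \<le> 1" by (auto simp: i_def j_def)
  ultimately have mk: "m = k" "i = j" by presburger+
  note tQ = trace_born[OF digit.hyps(1) Q m] and tR = trace_born[OF R(1) R1 k]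
  have eq: "snd (snd (advance (trace Q) X)) = snd (snd (advance (trace R) Y))"
    using digit.prems(2) trace_append_digit digit.hyps(2) R by metis
  show ?case
  proof (cases "X = (0, 0, 0)")
    case True
    then have "Y = (0, 0, 0)" using mk(2) by (auto simp: i_def j_def split: if_splits)
    then have "cell_of Q = cell_of R" using eq True Q R1 by simp
    then show ?thesis using digit.IH R \<open>Y = (0, 0, 0)\<close> True by blast
  next
    case False
    then have Y: "Y \<noteq> (0, 0, 0)" using mk(2) by (auto simp: i_def j_def split: if_splits)
    obtain a b where ab: "turn L0 (a0, b0) X = (a, b)" by fastforce
    obtain c d where cd: "turn L1 (a1, b1) Y = (c, d)" by fastforce
    have dirs: "(a, b) \<in> dirs" "(c, d) \<in> dirs"
      using turn_dirs[of "(a0, b0)" L0 X] turn_dirs[of "(a1, b1)" L1 Y] tQ tR ab cd by auto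
    have e: "2 * x0 + a = 2 * x1 + c" "2 * y0 + b = 2 * y1 + d"
      using eq Q R1 False Y ab cd by auto
    have "(x0, y0) \<in> born m" "(x1, y1) \<in> born m" using tQ tR mk(1) by blast+
    \<comment> \<open>Both cells before the last step belong to generation \<open>m\<close>, so they
      are not adjacent; their doubles share a neighboring midpoint, so they coincide.\<close>
    then have "(x1, y1) \<notin> neighbors (x0, y0)" using born_neighbor by blast
    then have "(x1 - x0, y1 - y0) = (0, 0)"
      using half_step[OF dirs, of "x1 - x0" "y1 - y0"] e unfolding neighbors_iff
      by (simp add: algebra_simps)
    then have xy: "(x0, y0) = (x1, y1)" by simp
    then have QR: "Q = R" using digit.IH[OF R(1)] Q R1 by simp
    have "turn L0 (a0, b0) X = turn L0 (a0, b0) Y"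
      using ab cd e xy QR Q R1 by auto
    then have "X = Y"
      using turn_inject[of L0 X Y "(a0, b0)"] tQ digit.hyps(2) R(2) False Y by blast
    with QR R show ?thesis by simp
  qed
qed

text \<open>The generation is halved: a cell of an even one is a double, and a cell of an odd one is
  a step from a double whose direction determines the last digit.\<close>

lemma cell_of_surj:
  "c \<in> born n \<Longrightarrow> \<exists>P\<in>P_positions. counters P = 2 * n \<and> cell_of P = c"
proof (induction n arbitrary: c rule: less_induct)
  case (less n)
  show ?case
  proof (cases "n = 0")
    case True
    with less.prems show ?thesis
      using zero_P_position by (intro bexI[of _ "(0, 0, 0)"]) (auto simp: trace_zero)
  next
    case False
    define m where "m = n div 2"
    have "m < n" using False by (simp add: m_def)
    show ?thesis
    proof (cases "even n")
      case True
      then have n: "n = 2 * m" "m > 0" using False by (auto simp: m_def)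
      obtain x y where c: "c = (2 * x, 2 * y)" "(x, y) \<in> born m"
        using born_even_cases less.prems n by metis
      obtain Q where Q: "Q \<in> P_positions" "counters Q = 2 * m" "cell_of Q = (x, y)"
        using less.IH[OF \<open>m < n\<close> c(2)] by blast
      have "cell_of (append_digit Q (0, 0, 0)) = c"
        using Q(3) c(1) by (cases "trace Q") (auto simp: trace_append_digit)
      moreover have "counters (append_digit Q (0, 0, 0)) = 2 * n"
        using Q(2) n by (cases Q) auto
      moreover have "append_digit Q (0, 0, 0) \<in> P_positions"
        using append_digit_P_position Q(1) by blast
      ultimately show ?thesis by blast
    next
      case odd: False
      then have n: "n = 2 * m + 1" by (simp add: m_def)
      obtain x y a b where c: "c = (2 * x + a, 2 * y + b)" "(a, b) \<in> dirs"
        "(x, y) \<in> born m" "(x + a, y + b) \<notin> alive m" "(2 * x + a, 2 * y + b) \<noteq> (0, -1)"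
        using born_odd_cases less.prems n by metis
      obtain Q where Q: "Q \<in> P_positions" "counters Q = 2 * m" "cell_of Q = (x, y)"
        using less.IH[OF \<open>m < n\<close> c(3)] by blast
      then obtain L a0 b0 where tQ: "trace Q = (L, (a0, b0), (x, y))" by (cases "trace Q") auto
      note tb = trace_born[OF Q(1) tQ Q(2)]
      \<comment> \<open>Going back is impossible: the cell behind is alive while the far end is
        dead, and behind the origin lies the missing midpoint.\<close>
      have "(a, b) \<noteq> (- a0, - b0)"
      proof
        assume e: "(a, b) = (- a0, - b0)"
        show False
        proof (cases "Q = (0, 0, 0)")
          case True
          with tQ tb e c(5) show False by (auto simp: trace_zero)
        next
          case False
          then have "(x - a0, y - b0) \<in> alive m" using tb alive_mono[of "m - 1" m] by auto
          with e c(4) show False by simp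
        qed
      qed
      then obtain X where X: "X \<in> masks" "turn L (a0, b0) X = (a, b)"
        using turn_surj tb c(2) by blast
      have "cell_of (append_digit Q X) = c"
        using X c(1) tQ by (auto simp: trace_append_digit masks_def)
      moreover have "counters (append_digit Q X) = 2 * n"
        using Q(2) n X(1) by (cases Q) (auto simp: masks_def)
      moreover have "append_digit Q X \<in> P_positions"
        using append_digit_P_position Q(1) X(1) by blast
      ultimately show ?thesis by blast
    qed
  qed
qed

section \<open>Agreement of the two parent relations\<close>

lemma nim_parent_imp_automaton_parent:
  assumes "nim_parent P Q"
  shows "automaton_parent (cell_of P) (cell_of Q)"
proof -
  obtain M where PQ: "P \<in> P_positions" "Q \<in> P_positions" "M \<in> masks" "Q = pos_add P M"
    using assms nim_parent_iff by blast
  obtain L a b x y where Q: "trace Q = (L, (a, b), (x, y))" by (cases "trace Q") auto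
  obtain L' e' x' y' where P: "trace P = (L', e', (x', y'))" by (cases "trace P") auto
  obtain n where n: "counters Q = 2 * n" using even_counters[OF PQ(2)] by blast
  have "Q \<noteq> (0, 0, 0)" using PQ by (cases P) (auto simp: masks_def)
  then have t: "n > 0" "(x, y) \<in> born n" "(x - a, y - b) \<in> alive (n - 1)" "(a, b) \<in> dirs"
    using trace_born[OF PQ(2) Q n] by auto
  have "(x - a, y - b) \<in> neighbors (x, y)"
    using t(4) unfolding neighbors_iff by (auto simp: dirs_def)
  moreover have "(x', y') = (x - a, y - b)"
    using trace_parent[OF PQ(2,1,3,4) Q P] by simp
  ultimately show ?thesis
    unfolding automaton_parent_def using t P Q
    by (intro exI[of _ "n - 1"]) (simp del: born.simps neighbors.simps)
qed

lemma automaton_parent_unique: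
  assumes "automaton_parent c d" "automaton_parent c' d"
  shows "c = c'"
proof -
  obtain n where n: "d \<in> born (Suc n)" "c \<in> neighbors d" "c \<in> alive n"
    using assms(1) automaton_parent_def by blast
  obtain m where m: "d \<in> born (Suc m)" "c' \<in> neighbors d" "c' \<in> alive m"
    using assms(2) automaton_parent_def by blast
  have "m = n" using born_disjoint[OF m(1) n(1)] by simp
  with n m show ?thesis
    using unique_alive_neighbor[OF n(1,2) _ m(2)] by auto
qed

theorem theorem25:
  "\<exists>\<Phi> :: position \<Rightarrow> cell.
     bij_betw \<Phi> P_positions automaton_cells \<and>
     (\<forall>p1 p2 p3 n. (p1, p2, p3) \<in> P_positions \<longrightarrow> p1 + p2 + p3 = 2 * n \<longrightarrow>
        \<Phi> (p1, p2, p3) \<in> born n) \<and>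
     (\<forall>P1 \<in> P_positions. \<forall>P2 \<in> P_positions.
        nim_parent P1 P2 \<longleftrightarrow> automaton_parent (\<Phi> P1) (\<Phi> P2))"
proof (intro exI[of _ cell_of] conjI allI ballI impI)
  show "bij_betw cell_of P_positions automaton_cells"
  proof (rule bij_betw_imageI)
    show "inj_on cell_of P_positions" using cell_of_inj by (auto intro!: inj_onI)
    show "cell_of ` P_positions = automaton_cells"
    proof (intro equalityI subsetI)
      fix c assume "c \<in> cell_of ` P_positions"
      then obtain P where "P \<in> P_positions" "c = cell_of P" by blast
      moreover obtain n where "counters P = 2 * n"
        using even_counters[OF \<open>P \<in> P_positions\<close>] by blast
      ultimately have "c \<in> alive n" using cell_of_born born_alive by blast
      then show "c \<in> automaton_cells" unfolding automaton_cells_def by blast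
    next
      fix c assume "c \<in> automaton_cells"
      then obtain n where "c \<in> born n" using alive_born unfolding automaton_cells_def by blast
      then show "c \<in> cell_of ` P_positions" using cell_of_surj by blast
    qed
  qed
next
  fix p1 p2 p3 n assume "(p1, p2, p3) \<in> P_positions" "p1 + p2 + p3 = 2 * n"
  then show "cell_of (p1, p2, p3) \<in> born n" by (simp add: cell_of_born)
next
  fix P1 P2 assume P: "P1 \<in> P_positions" "P2 \<in> P_positions"
  show "nim_parent P1 P2 \<longleftrightarrow> automaton_parent (cell_of P1) (cell_of P2)"
  proof
    \<comment> \<open>The converse needs no inverse construction: some Nim parent of
      \<open>P2\<close> maps to the automaton parent, which is unique, so injectivity identifies it
      with \<open>P1\<close>. The origin, always alive, has no parent.\<close>
    assume a: "automaton_parent (cell_of P1) (cell_of P2)"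
    have "P2 \<noteq> (0, 0, 0)"
    proof
      assume "P2 = (0, 0, 0)"
      then obtain n where "(0, 0) \<in> born (Suc n)"
        using a unfolding automaton_parent_def by (auto simp: trace_zero)
      then show False using born_Suc_iff origin_alive by blast
    qed
    then obtain P where "nim_parent P P2" using nim_parent_exists P by blast
    moreover from this have "cell_of P = cell_of P1"
      using automaton_parent_unique[OF _ a] nim_parent_imp_automaton_parent by blast
    then have "P = P1" using cell_of_inj P \<open>nim_parent P P2\<close> nim_parent_iff by blast
    ultimately show "nim_parent P1 P2" by simp
  qed (rule nim_parent_imp_automaton_parent)
qed

end
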